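(* Let $r(n)$ be the number (modulo the action of $S_3$ on the colors) of positive rigid color vectors valid for trees with $n$ carets. Then $r(1)=1$, $r(2)=2$ and $r(n+1)=r(n)+2r(n-1)+1$ for $n\ge2$.
   Context: Finite binary trees are rooted, planar; every vertex has $0$ or two (ordered: left, right) children except the root $*$, which has degree $1$ and a single child $\emptyset$. A tree with $n$ carets is a tree with $n$ internal vertices (vertices of degree $3$), hence with $n+1$ leaves, numbered left to right. Colors are elements of $\mathbb Z_2\times\mathbb Z_2$, coded $0=(0,0)$, $1=(0,1)$, $2=(1,0)$, $3=(1,1)$. A color vector $\mathbf c=(c_1,\dots,c_{n+1})$ for such a tree determines the unique edge coloring in which the edge at the $i$-th leaf has color $c_i$ and the three edges at each internal vertex sum to $0$. It is valid for the tree if this is a proper edge coloring using only colors $1,2,3$. A valid color vector gives each internal vertex a derived sign: $+$ if the colors of its (parent edge, left child edge, right child edge) form a cyclic permutation of $(1,2,3)$, and $-$ otherwise. A sign assignment is rigid if any two adjacent internal vertices have opposite signs, and positive rigid if moreover the top internal vertex $\emptyset$ is positive. A color vector is positive rigid if it is valid for some tree and its derived sign assignment is positive rigid on one (equivalently every) tree for which it is valid. $S_3$ acts by permuting the colors $1,2,3$; $r(n)$ is the number of $S_3$-orbits containing a positive rigid vector of length $n+1$, equivalently the number of positive rigid vectors of length $n+1$ whose root edge color (the sum of the entries) is $1$. *)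

theory Defs
  imports "HOL-Library.Tree" "HOL-Library.Z2" "HOL-Library.Product_Plus"
    "HOL-Combinatorics.Permutations"
begin

text \<open>A \<open>unit tree\<close> is the part of a finite binary tree at and below the child of the degree-one root
  \<open>*\<close>: its nodes are the carets (internal vertices) and its leaves are the leaves. A vertex other
  than \<open>*\<close> is the path leading to it from the child of \<open>*\<close>, so the top vertex is \<open>[]\<close>. The edge from
  a vertex to its parent is represented by the vertex itself; in particular the edge at \<open>*\<close> is \<open>[]\<close>.\<close>

type_synonym btree = "unit tree"

datatype side = Lft | Rgt

type_synonym vertex = "side list"

fun internal :: "btree \<Rightarrow> vertex set" where
  "internal Leaf = {}"
| "internal (Node s _ t) = {[]} \<union> Cons Lft ` internal s \<union> Cons Rgt ` internal t"

fun leaves :: "btree \<Rightarrow> vertex list" where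
  "leaves Leaf = [[]]"
| "leaves (Node s _ t) = map (Cons Lft) (leaves s) @ map (Cons Rgt) (leaves t)"

definition edges :: "btree \<Rightarrow> vertex set" where
  "edges t = internal t \<union> set (leaves t)"

type_synonym color = "bit \<times> bit"

abbreviation col1 :: color where "col1 \<equiv> (0, 1)"
abbreviation col2 :: color where "col2 \<equiv> (1, 0)"
abbreviation col3 :: color where "col3 \<equiv> (1, 1)"

text \<open>The values of an edge coloring outside \<open>edges t\<close> are irrelevant; on \<open>edges t\<close> it is determined
  by \<open>t\<close> and the color vector (see \<open>induces_unique\<close> and \<open>induces_exists\<close> below).\<close>

definition induces :: "btree \<Rightarrow> color list \<Rightarrow> (vertex \<Rightarrow> color) \<Rightarrow> bool" where
  "induces t c \<kappa> \<longleftrightarrow> map \<kappa> (leaves t) = c \<and>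
     (\<forall>v \<in> internal t. \<kappa> v + \<kappa> (v @ [Lft]) + \<kappa> (v @ [Rgt]) = 0)"

definition proper_coloring :: "btree \<Rightarrow> (vertex \<Rightarrow> color) \<Rightarrow> bool" where
  "proper_coloring t \<kappa> \<longleftrightarrow> (\<forall>e \<in> edges t. \<kappa> e \<in> {col1, col2, col3}) \<and>
     (\<forall>v \<in> internal t. distinct [\<kappa> v, \<kappa> (v @ [Lft]), \<kappa> (v @ [Rgt])])"

definition valid :: "btree \<Rightarrow> color list \<Rightarrow> bool" where
  "valid t c \<longleftrightarrow> (\<exists>\<kappa>. induces t c \<kappa> \<and> proper_coloring t \<kappa>)"

datatype sign = Plus | Minus

definition derived_sign :: "(vertex \<Rightarrow> color) \<Rightarrow> vertex \<Rightarrow> sign" where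
  "derived_sign \<kappa> v =
     (if (\<kappa> v, \<kappa> (v @ [Lft]), \<kappa> (v @ [Rgt]))
           \<in> {(col1, col2, col3), (col2, col3, col1), (col3, col1, col2)}
      then Plus else Minus)"

definition rigid :: "btree \<Rightarrow> (vertex \<Rightarrow> sign) \<Rightarrow> bool" where
  "rigid t \<sigma> \<longleftrightarrow>
     (\<forall>v \<in> internal t. \<forall>d. v @ [d] \<in> internal t \<longrightarrow> \<sigma> (v @ [d]) \<noteq> \<sigma> v)"

definition positive_rigid :: "btree \<Rightarrow> (vertex \<Rightarrow> sign) \<Rightarrow> bool" where
  "positive_rigid t \<sigma> \<longleftrightarrow> rigid t \<sigma> \<and> [] \<in> internal t \<and> \<sigma> [] = Plus"

definition positive_rigid_vector :: "color list \<Rightarrow> bool" where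
  "positive_rigid_vector c \<longleftrightarrow>
     (\<exists>t \<kappa>. valid t c \<and> induces t c \<kappa> \<and> positive_rigid t (derived_sign \<kappa>))"

definition color_orbit :: "color list \<Rightarrow> color list set" where
  "color_orbit c = {map p c | p. p permutes {col1, col2, col3}}"

definition rigid_count :: "nat \<Rightarrow> nat" where
  "rigid_count n = card (color_orbit ` {c. length c = n + 1 \<and> positive_rigid_vector c})"

lemma induces_Node:
  "induces (Node s u t) c \<kappa> \<longleftrightarrow>
     (\<exists>a b. c = a @ b \<and> induces s a (\<lambda>v. \<kappa> (Lft # v)) \<and> induces t b (\<lambda>v. \<kappa> (Rgt # v))) \<and>
     \<kappa> [] + \<kappa> [Lft] + \<kappa> [Rgt] = 0"
  by (auto simp: induces_def o_def ball_Un)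

lemma length_leaves: "length (leaves t) = size t + 1"
  by (induction t) auto

lemma induces_exists:
  assumes "length c = size t + 1"
  shows "\<exists>\<kappa>. induces t c \<kappa>"
  using assms
proof (induction t arbitrary: c)
  case Leaf
  then obtain x where "c = [x]" by (auto simp: length_Suc_conv)
  then show ?case by (auto simp: induces_def intro!: exI[of _ "\<lambda>_. x"])
next
  case (Node s u t)
  let ?a = "take (size s + 1) c" and ?b = "drop (size s + 1) c"
  obtain f g where f: "induces s ?a f" and g: "induces t ?b g"
    using Node.IH(1)[of ?a] Node.IH(2)[of ?b] Node.prems by auto
  define \<kappa> where "\<kappa> v = (case v of [] \<Rightarrow> - (f [] + g []) | Lft # w \<Rightarrow> f w | Rgt # w \<Rightarrow> g w)" for v
  have "c = ?a @ ?b" by simp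
  moreover have "induces s ?a (\<lambda>v. \<kappa> (Lft # v))" "induces t ?b (\<lambda>v. \<kappa> (Rgt # v))"
    using f g by (simp_all add: \<kappa>_def)
  moreover have "\<kappa> [] + \<kappa> [Lft] + \<kappa> [Rgt] = 0"
    by (simp add: \<kappa>_def del: minus_add_distrib)
  ultimately show ?case unfolding induces_Node by blast
qed

lemma Nil_in_edges: "[] \<in> edges t"
  by (cases t) (auto simp: edges_def)

lemma induces_unique:
  assumes "induces t c f" "induces t c g" "e \<in> edges t"
  shows "f e = g e"
  using assms
proof (induction t arbitrary: c f g e)
  case Leaf
  then show ?case by (auto simp: induces_def edges_def)
next
  case (Node s u t)
  obtain a b where ab: "c = a @ b" "induces s a (\<lambda>v. f (Lft # v))" "induces t b (\<lambda>v. f (Rgt # v))"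
    and f0: "f [] + f [Lft] + f [Rgt] = 0"
    using Node.prems(1) unfolding induces_Node by blast
  obtain a' b' where ab': "c = a' @ b'" "induces s a' (\<lambda>v. g (Lft # v))"
      "induces t b' (\<lambda>v. g (Rgt # v))" and g0: "g [] + g [Lft] + g [Rgt] = 0"
    using Node.prems(2) unfolding induces_Node by blast
  have "length a = length a'" using ab(2) ab'(2) by (auto simp: induces_def)
  then have eq: "a' = a" "b' = b" using ab(1) ab'(1) by auto
  have L: "f (Lft # v) = g (Lft # v)" if "v \<in> edges s" for v
    using Node.IH(1)[OF ab(2) ab'(2)[unfolded eq] that] .
  have R: "f (Rgt # v) = g (Rgt # v)" if "v \<in> edges t" for v
    using Node.IH(2)[OF ab(3) ab'(3)[unfolded eq] that] .
  have "f [] = g []"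
    using f0 g0 L[OF Nil_in_edges] R[OF Nil_in_edges] by (metis add_right_imp_eq)
  moreover have "e = [] \<or> (\<exists>v \<in> edges s. e = Lft # v) \<or> (\<exists>v \<in> edges t. e = Rgt # v)"
    using Node.prems(3) by (auto simp: edges_def)
  ultimately show ?case using L R by auto
qed

end

theory Submission imports Defs begin

text \<open>
  In a positive rigid coloring the sign of a vertex is the parity of its depth, so the coloring is
  determined by the color \<open>x\<close> of the root edge: going down a left edge from an even vertex, or a right
  edge from an odd vertex, rotates the color once along \<open>1 \<rightarrow> 2 \<rightarrow> 3 \<rightarrow> 1\<close>, and the other two kinds of
  edges rotate it twice. Identify the colors with \<open>\<int>/3\<close>, and let \<open>s\<^sub>i = 1\<close> or \<open>s\<^sub>i = -1\<close> according to
  whether the depth of the \<open>i\<close>-th leaf is even or odd. Then the \<open>i\<close>-th leaf has the color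
  \<open>x - 1 + 2(s\<^sub>1 + \<dots> + s\<^bsub>i-1\<^esub>) + s\<^sub>i\<close> (\<open>paint_depth_parities\<close>). The color vector therefore does not
  depend on the tree beyond the list of its leaf depth parities, and for a given \<open>x\<close> it determines that
  list (\<open>paint_inject\<close>). This reduces the count to that of the lists of leaf depth parities.

  The lists that arise from the trees with at least one caret are exactly those with
  \<open>s\<^sub>1 + \<dots> + s\<^bsub>n+1\<^esub> \<equiv> 1 (mod 3)\<close> that have two equal neighbors. The congruence holds because replacing
  a leaf by a caret replaces \<open>s\<close> by \<open>-s, -s\<close> and \<open>-2s \<equiv> s\<close>; equal neighbors exist because a tree has
  a caret with two leaves. Conversely, two equal neighbors \<open>s, s\<close> can be contracted to \<open>-s\<close>, and the
  pair can be chosen such that the shorter list still has equal neighbors or is a single \<open>1\<close>, so that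
  induction applies (\<open>contraction_not_alternating\<close>, \<open>depth_parities_surj\<close>).

  Each orbit corresponds to exactly one list. Permutations of the colors are additive and the entries
  of a vector add up to the root color, so two vectors with root color \<open>1\<close> in one orbit differ at most
  by the exchange of \<open>2\<close> and \<open>3\<close>; this exchange reverses all signs, and the vector of an even-rooted
  list can only become another such vector if the list alternates (\<open>swapped_paint_alternates\<close>).

  Finally, let \<open>a(N)\<close> be the number of sign lists of length \<open>N\<close> with sum \<open>1\<close> modulo \<open>3\<close>. A list of
  length \<open>N\<close> extends to exactly one such list by a sign in front, unless its own sum is \<open>1\<close> modulo
  \<open>3\<close>, in which case there is no extension; so \<open>a(N) + a(N + 1) = 2\<^sup>N\<close>. Among these lists the
  alternating ones number \<open>1\<close> for odd \<open>N\<close> and \<open>0\<close> for even \<open>N\<close>, hence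
  \<open>r(n) + r(n + 1) + 1 = 2\<^bsup>n+1\<^esup>\<close> (\<open>rigid_count_add\<close>), and two instances of this identity give the
  recurrence.
\<close>

section \<open>Rotating the three colors\<close>

text \<open>This is multiplication by a generator \<open>\<omega>\<close> of the unit group of the field with four elements. As
  \<open>1 + \<omega> + \<omega>\<^sup>2 = 0\<close>, a color and its two rotations add up to \<open>0\<close>.\<close>

definition rot :: "color \<Rightarrow> color" where
  "rot c = (fst c + snd c, fst c)"

lemma color_cases: "(x::color) \<in> {0, col1, col2, col3}"
proof -
  have "a = 0 \<or> a = 1" for a :: bit by (metis bit_not_one_iff)
  then show ?thesis by (cases x) (auto simp: zero_prod_def)
qed

lemma rot_simps [simp]: "rot 0 = 0" "rot col1 = col2" "rot col2 = col3" "rot col3 = col1"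
  by (simp_all add: rot_def zero_prod_def)

lemma color_neq [simp]: "col1 \<noteq> 0" "col2 \<noteq> 0" "col3 \<noteq> 0" "0 \<noteq> col1" "0 \<noteq> col2" "0 \<noteq> col3"
  by (simp_all add: zero_prod_def)

lemma nonzero_iff: "x \<in> {col1, col2, col3} \<longleftrightarrow> x \<noteq> 0"
  using color_cases[of x] by auto

lemma color_add_self [simp]: "(x::color) + x = 0"
  using color_cases[of x] by (auto simp: zero_prod_def)

lemma rot_rot_rot [simp]: "rot (rot (rot x)) = x"
  using color_cases[of x] by auto

lemma rot_eq_0_iff [simp]: "rot x = 0 \<longleftrightarrow> x = 0"
  by (metis rot_rot_rot rot_simps(1))

lemma rot_fixes_only_0: "rot x = x \<longleftrightarrow> x = 0"
  using color_cases[of x] by auto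

lemma add_rot_rot: "rot x + rot (rot x) = x"
  using color_cases[of x] by auto

lemma add_rot_rot': "rot (rot x) + rot x = x"
  using add_rot_rot[of x] by (simp add: add.commute)

section \<open>The rigid coloring with a given root color\<close>

text \<open>The flag \<open>b\<close> tells whether the parent vertex is positive, and \<open>x\<close> is the color above it.\<close>

definition child_color :: "bool \<Rightarrow> side \<Rightarrow> color \<Rightarrow> color" where
  "child_color b d x = (if b = (d = Lft) then rot x else rot (rot x))"

text \<open>Rigidity forces the signs to alternate with the depth, so the colors can be assigned to all
  vertices of the infinite binary tree at once; every finite tree takes its coloring by restriction.\<close>

fun rigid_coloring :: "bool \<Rightarrow> color \<Rightarrow> vertex \<Rightarrow> color" where
  "rigid_coloring b x [] = x"
| "rigid_coloring b x (d # v) = rigid_coloring (\<not> b) (child_color b d x) v"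

lemma child_color_nonzero [simp]: "child_color b d x = 0 \<longleftrightarrow> x = 0"
  by (simp add: child_color_def)

lemma child_color_add: "child_color b Lft x + child_color b Rgt x = x"
  by (simp add: child_color_def add_rot_rot add_rot_rot')

lemma edges_Node:
  "edges (Node s u t) = {[]} \<union> Cons Lft ` edges s \<union> Cons Rgt ` edges t"
  by (auto simp: edges_def)

lemma proper_coloring_Node:
  "proper_coloring (Node s u t) \<kappa> \<longleftrightarrow>
     \<kappa> [] \<in> {col1, col2, col3} \<and> distinct [\<kappa> [], \<kappa> [Lft], \<kappa> [Rgt]] \<and>
     proper_coloring s (\<lambda>v. \<kappa> (Lft # v)) \<and> proper_coloring t (\<lambda>v. \<kappa> (Rgt # v))"
  unfolding proper_coloring_def edges_Node internal.simps ball_Un ball_simps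
  by auto

lemma derived_sign_Cons: "derived_sign (\<lambda>v. \<kappa> (d # v)) v = derived_sign \<kappa> (d # v)"
  by (simp add: derived_sign_def)

lemma rigid_Node:
  "rigid (Node s u t) (derived_sign \<kappa>) \<longleftrightarrow>
     (s \<noteq> Leaf \<longrightarrow> derived_sign \<kappa> [Lft] \<noteq> derived_sign \<kappa> []) \<and>
     (t \<noteq> Leaf \<longrightarrow> derived_sign \<kappa> [Rgt] \<noteq> derived_sign \<kappa> []) \<and>
     rigid s (derived_sign (\<lambda>v. \<kappa> (Lft # v))) \<and> rigid t (derived_sign (\<lambda>v. \<kappa> (Rgt # v)))"
proof -
  have Nil: "[] \<in> internal r \<longleftrightarrow> r \<noteq> Leaf" for r by (cases r) auto
  have "(\<forall>d. P d) \<longleftrightarrow> P Lft \<and> P Rgt" for P by (metis side.exhaust)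
  then show ?thesis
    unfolding rigid_def internal.simps ball_Un ball_simps derived_sign_Cons
    by (auto simp: Nil image_iff)
qed

text \<open>The membership is the condition in \<open>derived_sign\<close>. Since the colors add up to \<open>0\<close>, the first two
  determine the third, which leaves the two cyclic orders.\<close>

lemma children_of_signed_vertex:
  assumes "x \<noteq> 0" "distinct [x, y, z]" "x + y + z = 0"
  shows "y = child_color ((x, y, z) \<in> {(col1, col2, col3), (col2, col3, col1), (col3, col1, col2)}) Lft x"
    (is "y = child_color (_ \<in> ?positive) Lft x")
    and "z = child_color ((x, y, z) \<in> {(col1, col2, col3), (col2, col3, col1), (col3, col1, col2)}) Rgt x"
proof -
  have "z = x + y"
    using assms(3) color_add_self[of "x + y"] by (metis add_left_imp_eq)
  moreover have "x \<in> {col1, col2, col3}" "y \<in> {0, col1, col2, col3}"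
    using assms(1) nonzero_iff color_cases by blast+
  ultimately show "y = child_color ((x, y, z) \<in> ?positive) Lft x"
    and "z = child_color ((x, y, z) \<in> ?positive) Rgt x"
    using assms(2) by (auto simp: child_color_def)
qed

text \<open>The sign of the top vertex fixes the colors of its two children, and rigidity passes the opposite
  sign on to them. A tree without carets has no sign to compare, so there \<open>b\<close> is unconstrained.\<close>

lemma rigid_coloring_unique:
  assumes "induces t c \<kappa>" "proper_coloring t \<kappa>" "rigid t (derived_sign \<kappa>)"
    and "t \<noteq> Leaf \<Longrightarrow> derived_sign \<kappa> [] = (if b then Plus else Minus)"
    and "v \<in> edges t"
  shows "\<kappa> v = rigid_coloring b (\<kappa> []) v"
  using assms
proof (induction t arbitrary: b c \<kappa> v)
  case Leaf
  then show ?case by (simp add: edges_def)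
next
  case (Node s u t)
  obtain a1 a2 where ind: "induces s a1 (\<lambda>v. \<kappa> (Lft # v))" "induces t a2 (\<lambda>v. \<kappa> (Rgt # v))"
    and sum: "\<kappa> [] + \<kappa> [Lft] + \<kappa> [Rgt] = 0"
    using Node.prems(1) unfolding induces_Node by blast
  note proper = Node.prems(2)[unfolded proper_coloring_Node]
  note rig = Node.prems(3)[unfolded rigid_Node]
  have sgn: "derived_sign \<kappa> [] = (if b then Plus else Minus)"
    using Node.prems(4) by simp
  have b: "b \<longleftrightarrow> (\<kappa> [], \<kappa> [Lft], \<kappa> [Rgt]) \<in>
      {(col1, col2, col3), (col2, col3, col1), (col3, col1, col2)}"
    using sgn by (simp add: derived_sign_def split: if_splits)
  have x: "\<kappa> [] \<noteq> 0" using proper nonzero_iff by blast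
  have L: "\<kappa> [Lft] = child_color b Lft (\<kappa> [])" and R: "\<kappa> [Rgt] = child_color b Rgt (\<kappa> [])"
    using children_of_signed_vertex[OF x _ sum] proper unfolding b by blast+
  have sgn': "derived_sign \<kappa> [Lft] = (if \<not> b then Plus else Minus)" if "s \<noteq> Leaf"
    using rig sgn that sign.exhaust by metis
  have sgn'': "derived_sign \<kappa> [Rgt] = (if \<not> b then Plus else Minus)" if "t \<noteq> Leaf"
    using rig sgn that sign.exhaust by metis
  consider "v = []" | w where "v = Lft # w" "w \<in> edges s" | w where "v = Rgt # w" "w \<in> edges t"
    using Node.prems(5) by (auto simp: edges_Node)
  then show ?case
  proof cases
    case 1
    then show ?thesis by simp
  next
    case 2
    have "\<kappa> (Lft # w) = rigid_coloring (\<not> b) (\<kappa> [Lft]) w"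
      using Node.IH(1)[OF ind(1) _ _ _ 2(2)] proper rig sgn' unfolding derived_sign_Cons by blast
    then show ?thesis using 2 L by simp
  next
    case 3
    have "\<kappa> (Rgt # w) = rigid_coloring (\<not> b) (\<kappa> [Rgt]) w"
      using Node.IH(2)[OF ind(2) _ _ _ 3(2)] proper rig sgn'' unfolding derived_sign_Cons by blast
    then show ?thesis using 3 R by simp
  qed
qed

lemma derived_sign_rigid_coloring:
  assumes "x \<noteq> 0"
  shows "derived_sign (rigid_coloring b x) v = (if even (length v) = b then Plus else Minus)"
  using assms
proof (induction v arbitrary: b x)
  case Nil
  then show ?case
    using color_cases[of x] by (auto simp: derived_sign_def child_color_def)
next
  case (Cons d v)
  have "derived_sign (rigid_coloring b x) (d # v) =
      derived_sign (rigid_coloring (\<not> b) (child_color b d x)) v"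
    by (simp add: derived_sign_def)
  then show ?case using Cons by auto
qed

lemma rigid_rigid_coloring: "x \<noteq> 0 \<Longrightarrow> rigid t (derived_sign (rigid_coloring b x))"
  by (auto simp: rigid_def derived_sign_rigid_coloring)

lemma proper_rigid_coloring: "x \<noteq> 0 \<Longrightarrow> proper_coloring t (rigid_coloring b x)"
proof (induction t arbitrary: b x)
  case Leaf
  then show ?case using nonzero_iff[of x] by (simp add: proper_coloring_def edges_def)
next
  case (Node s u t)
  have "distinct [x, child_color b Lft x, child_color b Rgt x]"
    using Node.prems color_cases[of x] by (auto simp: child_color_def)
  then show ?case
    using Node nonzero_iff[of x] by (simp add: proper_coloring_Node)
qed

lemma induces_rigid_coloring:
  "induces t (map (rigid_coloring b x) (leaves t)) (rigid_coloring b x)"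
proof (induction t arbitrary: b x)
  case Leaf
  then show ?case by (simp add: induces_def)
next
  case (Node s u t)
  have "x + child_color b Lft x + child_color b Rgt x = 0"
    by (simp add: add.assoc child_color_add)
  then show ?case
    unfolding induces_Node
    using Node.IH(1)[of "\<not> b" "child_color b Lft x"] Node.IH(2)[of "\<not> b" "child_color b Rgt x"]
    by (auto simp: o_def)
qed

lemma positive_rigid_vector_iff_rigid_coloring:
  "positive_rigid_vector c \<longleftrightarrow>
     (\<exists>t x. t \<noteq> Leaf \<and> x \<noteq> 0 \<and> c = map (rigid_coloring True x) (leaves t))"
proof
  assume "positive_rigid_vector c"
  then obtain t \<kappa> \<kappa>' where val: "induces t c \<kappa>'" "proper_coloring t \<kappa>'" and ind: "induces t c \<kappa>"
    and pos: "positive_rigid t (derived_sign \<kappa>)"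
    unfolding positive_rigid_vector_def valid_def by blast
  have agree: "\<kappa> e = \<kappa>' e" if "e \<in> edges t" for e
    using induces_unique[OF ind val(1) that] .
  \<comment> \<open>Properness looks at the edges of the tree only, so it carries over from \<open>\<kappa>'\<close> to \<open>\<kappa>\<close>.\<close>
  have "v @ [d] \<in> edges t" if "v \<in> internal t" for v d
    using that
  proof (induction t arbitrary: v)
    case (Node s u t)
    then show ?case
      by (cases d) (auto simp: edges_Node Nil_in_edges)
  qed simp
  then have proper: "proper_coloring t \<kappa>"
    using val(2) agree unfolding proper_coloring_def by (auto simp: edges_def)
  have t: "t \<noteq> Leaf" using pos by (auto simp: positive_rigid_def)
  have "\<kappa> v = rigid_coloring True (\<kappa> []) v" if "v \<in> set (leaves t)" for v
    using rigid_coloring_unique[OF ind proper, of True v] pos that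
    by (simp add: positive_rigid_def edges_def)
  then have "c = map (rigid_coloring True (\<kappa> [])) (leaves t)"
    using ind by (auto simp: induces_def)
  moreover have "\<kappa> [] \<noteq> 0"
    using proper Nil_in_edges nonzero_iff unfolding proper_coloring_def by blast
  ultimately show "\<exists>t x. t \<noteq> Leaf \<and> x \<noteq> 0 \<and> c = map (rigid_coloring True x) (leaves t)"
    using t by blast
next
  assume "\<exists>t x. t \<noteq> Leaf \<and> x \<noteq> 0 \<and> c = map (rigid_coloring True x) (leaves t)"
  then obtain t x where *: "t \<noteq> Leaf" "x \<noteq> 0" "c = map (rigid_coloring True x) (leaves t)"
    by blast
  have "[] \<in> internal t" using *(1) by (cases t) auto
  then show "positive_rigid_vector c"
    unfolding positive_rigid_vector_def valid_def positive_rigid_def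
    using *(2,3) induces_rigid_coloring[of t True x] proper_rigid_coloring[OF *(2), of t True]
      rigid_rigid_coloring[OF *(2), of t True] derived_sign_rigid_coloring[OF *(2), of True "[]"]
    by (metis even_zero list.size(3))
qed

lemma sum_list_rigid_coloring: "sum_list (map (rigid_coloring b x) (leaves t)) = x"
  by (induction t arbitrary: b x) (simp_all add: o_def child_color_add)

section \<open>Color vectors from leaf depth parities\<close>

text \<open>\<open>True\<close> stands for even depth, where the top vertex has parity \<open>b\<close>.\<close>

fun depth_parities :: "bool \<Rightarrow> btree \<Rightarrow> bool list" where
  "depth_parities b Leaf = [b]"
| "depth_parities b (Node s _ t) = depth_parities (\<not> b) s @ depth_parities (\<not> b) t"

text \<open>A transducer that reads parities and writes colors. With colors in \<open>\<int>/3\<close>, its state is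
  \<open>e = x + 2(s\<^sub>1 + \<dots> + s\<^bsub>i-1\<^esub>)\<close>, where \<open>x\<close> is the color of an even root; it writes \<open>e - 1 + s\<^sub>i\<close> and moves
  to \<open>e - s\<^sub>i\<close>.\<close>

fun paint :: "color \<Rightarrow> bool list \<Rightarrow> color list" where
  "paint e [] = []"
| "paint e (True # bs) = e # paint (rot (rot e)) bs"
| "paint e (False # bs) = rot e # paint (rot e) bs"

text \<open>The state in which the transducer arrives at a subtree whose top edge has color \<open>x\<close>. A leaf under
  an odd edge is painted \<open>rot e\<close>, hence \<open>e\<close> must lie one step before \<open>x\<close>.\<close>

definition entry_state :: "bool \<Rightarrow> color \<Rightarrow> color" where
  "entry_state b x = (if b then x else rot (rot x))"

text \<open>The transducer leaves a subtree of parity \<open>b\<close> in the state in which it would enter one of the other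
  parity with the same color. That is the state in which the right child has to be entered after the
  left one, and after both children it is the exit state of the parent, so the induction closes.\<close>

lemma paint_depth_parities_append:
  "paint (entry_state b x) (depth_parities b t @ bs) =
     map (rigid_coloring b x) (leaves t) @ paint (entry_state (\<not> b) x) bs"
proof (induction t arbitrary: b x bs)
  case Leaf
  then show ?case by (cases b) (simp_all add: entry_state_def)
next
  case (Node s u t)
  have 1: "entry_state b x = entry_state (\<not> b) (child_color b Lft x)"
    and 2: "entry_state b (child_color b Lft x) = entry_state (\<not> b) (child_color b Rgt x)"
    and 3: "entry_state b (child_color b Rgt x) = entry_state (\<not> b) x"
    by (simp_all add: entry_state_def child_color_def)
  show ?case
    using Node.IH(1)[of "\<not> b" "child_color b Lft x" "depth_parities (\<not> b) t @ bs"]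
      Node.IH(2)[of "\<not> b" "child_color b Rgt x" bs]
    by (simp add: 1 2 3 o_def)
qed

lemma paint_depth_parities:
  "paint x (depth_parities True t) = map (rigid_coloring True x) (leaves t)"
  using paint_depth_parities_append[of True x t "[]"] by (simp add: entry_state_def)

lemma length_paint [simp]: "length (paint e bs) = length bs"
  by (induction e bs rule: paint.induct) auto

text \<open>In a nonzero state the two parities yield different colors, so the input can be read off.\<close>

lemma paint_inject:
  assumes "e \<noteq> 0" "paint e bs = paint e bs'"
  shows "bs = bs'"
  using assms
proof (induction e bs arbitrary: bs' rule: paint.induct)
  case (1 e)
  then show ?case by (metis length_0_conv length_paint)
next
  case (2 e bs)
  then obtain b cs where "bs' = b # cs" by (cases bs') auto
  with 2 show ?case
    by (cases b) (use rot_fixes_only_0[of e] in auto)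
next
  case (3 e bs)
  then obtain b cs where "bs' = b # cs" by (cases bs') auto
  with 3 show ?case
    by (cases b) (use rot_fixes_only_0[of e] in auto)
qed

lemma map_rot_paint: "map rot (paint e bs) = paint (rot e) bs"
  by (induction e bs rule: paint.induct) auto

text \<open>In state \<open>1\<close> the transducer writes \<open>1\<close> or \<open>2\<close>, and only \<open>1\<close> is written as one of these after the
  exchange of \<open>2\<close> and \<open>3\<close>; so the parity is even and the next state is \<open>3\<close>. There it writes \<open>3\<close> or \<open>1\<close>,
  of which only \<open>1\<close> remains possible after the exchange; so the parity is odd and the state returns
  to \<open>1\<close>.\<close>

lemma swapped_paint_alternates:
  "map (transpose col2 col3) (paint col1 bs) = paint col1 bs' \<Longrightarrow>
     distinct_adj bs \<and> (bs \<noteq> [] \<longrightarrow> hd bs)"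
  "map (transpose col2 col3) (paint col3 bs) = paint col3 bs' \<Longrightarrow>
     distinct_adj bs \<and> (bs \<noteq> [] \<longrightarrow> \<not> hd bs)"
proof (induction bs arbitrary: bs')
  case Nil
  {
    case 1
    then show ?case by simp
  next
    case 2
    then show ?case by simp
  }
next
  case (Cons b bs)
  {
    case 1
    then obtain b' cs where "bs' = b' # cs" by (cases bs') (cases b, auto)
    with 1 Cons.IH(2)[of cs] show ?case
      by (cases b; cases b') (auto simp: distinct_adj_Cons transpose_def)
  next
    case 2
    then obtain b' cs where "bs' = b' # cs" by (cases bs') (cases b, auto)
    with 2 Cons.IH(1)[of cs] show ?case
      by (cases b; cases b') (auto simp: distinct_adj_Cons transpose_def)
  }
qed

section \<open>Which parity lists come from trees\<close>

fun excess :: "bool list \<Rightarrow> int" where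
  "excess [] = 0"
| "excess (b # bs) = (if b then 1 else -1) + excess bs"

lemma excess_append [simp]: "excess (as @ bs) = excess as + excess bs"
  by (induction as) auto

lemma excess_depth_parities: "excess (depth_parities b t) mod 3 = (if b then 1 else 2)"
proof (induction t arbitrary: b)
  case Leaf
  then show ?case by simp
next
  case (Node s u t)
  show ?case
    using Node.IH(1)[of "\<not> b"] Node.IH(2)[of "\<not> b"]
    by (auto split: if_splits) presburger+
qed

text \<open>Some caret has two leaves as children, and these have equal depth.\<close>

lemma depth_parities_not_alternating:
  "t \<noteq> Leaf \<Longrightarrow> \<not> distinct_adj (depth_parities b t)"
proof (induction t arbitrary: b)
  case (Node s u t)
  then show ?case
    by (cases "s = Leaf \<and> t = Leaf") (auto dest: distinct_adj_appendD1 distinct_adj_appendD2)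
qed simp

text \<open>The new caret replaces the leaf of parity \<open>y\<close>.\<close>

lemma graft_caret:
  assumes "depth_parities b t = us @ y # vs"
  shows "\<exists>t'. t' \<noteq> Leaf \<and> depth_parities b t' = us @ (\<not> y) # (\<not> y) # vs"
  using assms
proof (induction t arbitrary: b us vs)
  case Leaf
  then have "depth_parities b (Node Leaf () Leaf) = us @ (\<not> y) # (\<not> y) # vs"
    by (simp add: Cons_eq_append_conv)
  then show ?case by blast
next
  case (Node s u t)
  let ?S = "depth_parities (\<not> b) s" and ?T = "depth_parities (\<not> b) t"
  from Node.prems consider ws where "?S = us @ y # ws" "vs = ws @ ?T"
    | ws where "?T = ws @ y # vs" "us = ?S @ ws"
    by (auto simp: append_eq_append_conv2 append_eq_Cons_conv Cons_eq_append_conv)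
  then show ?case
  proof cases
    case 1
    then obtain s' where "depth_parities (\<not> b) s' = us @ (\<not> y) # (\<not> y) # ws"
      using Node.IH(1) by blast
    then have "depth_parities b (Node s' () t) = us @ (\<not> y) # (\<not> y) # vs" using 1 by simp
    then show ?thesis by blast
  next
    case 2
    then obtain t' where "depth_parities (\<not> b) t' = ws @ (\<not> y) # (\<not> y) # vs"
      using Node.IH(2) by blast
    then have "depth_parities b (Node s () t') = us @ (\<not> y) # (\<not> y) # vs" using 2 by simp
    then show ?thesis by blast
  qed
qed

lemma not_distinct_adjE:
  assumes "\<not> distinct_adj bs"
  obtains us x vs where "bs = us @ x # x # vs"
proof -
  have "\<exists>us x vs. bs = us @ x # x # vs"
    using assms
  proof (induction bs)
    case (Cons b bs)
    show ?case
    proof (cases "distinct_adj bs")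
      case True
      with Cons.prems have "bs = b # tl bs"
        by (cases bs) (auto simp: distinct_adj_Cons)
      then show ?thesis by (metis append_Nil)
    next
      case False
      then show ?thesis using Cons.IH by (metis append_Cons)
    qed
  qed simp
  then show thesis using that by blast
qed

text \<open>Because \<open>2s \<equiv> -s (mod 3)\<close>.\<close>

lemma excess_contract: "excess (us @ (\<not> x) # vs) mod 3 = excess (us @ x # x # vs) mod 3"
  by (cases x; simp) presburger+

text \<open>If contracting a pair leaves an alternating list, then the neighbors of the pair have the same
  parity \<open>x\<close> as the pair, and there is one because the length exceeds \<open>2\<close>. Moving the pair by one
  position onto such a neighbor keeps a parity \<open>x\<close> on one side of the contracted pair, and a parity
  equal to \<open>\<not> x\<close> or a second \<open>x\<close> further out gives equal neighbors. The remaining list \<open>x, x, x\<close> has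
  excess divisible by \<open>3\<close>.\<close>

lemma contraction_not_alternating:
  assumes "\<not> distinct_adj bs" "length bs > 2" "excess bs mod 3 \<noteq> 0"
  obtains us x vs where "bs = us @ x # x # vs" "\<not> distinct_adj (us @ (\<not> x) # vs)"
proof -
  obtain us x vs where bs: "bs = us @ x # x # vs"
    using assms(1) by (rule not_distinct_adjE)
  show thesis
  proof (cases "distinct_adj (us @ (\<not> x) # vs)")
    case False
    then show ?thesis using that bs by blast
  next
    case alt: True
    show ?thesis
    proof (cases vs)
      case (Cons y ws)
      with alt have y: "y = x" by (auto simp: distinct_adj_append_iff)
      \<comment> \<open>Otherwise the list is \<open>x, x, x\<close>.\<close>
      have "us @ [x] \<noteq> [x] \<or> ws \<noteq> []"
        using assms(3) bs Cons y by auto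
      then have "\<not> distinct_adj ((us @ [x]) @ (\<not> x) # ws)"
      proof
        assume "us @ [x] \<noteq> [x]"
        then have "us \<noteq> []" by simp
        with alt have "last us = x" by (auto simp: distinct_adj_append_iff)
        with \<open>us \<noteq> []\<close> show ?thesis by (auto simp: distinct_adj_append_iff)
      next
        assume "ws \<noteq> []"
        then obtain z zs where "ws = z # zs" by (cases ws) auto
        with alt Cons y show ?thesis by (auto simp: distinct_adj_append_iff)
      qed
      then show ?thesis using that[of "us @ [x]" x ws] bs Cons y by simp
    next
      case Nil
      with assms(2) bs have "us \<noteq> []" by auto
      then obtain ws y where us: "us = ws @ [y]" by (metis rev_exhaust)
      with alt have y: "y = x" by (auto simp: distinct_adj_append_iff)
      have "ws \<noteq> []" using assms(3) bs Nil us y by auto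
      then obtain zs z where ws: "ws = zs @ [z]" by (metis rev_exhaust)
      with alt us y have "z \<noteq> x" by (auto simp: distinct_adj_append_iff)
      then have "\<not> distinct_adj (ws @ (\<not> x) # [x])"
        using ws by (auto simp: distinct_adj_append_iff)
      then show ?thesis using that[of ws x "[x]"] bs Nil us y by simp
    qed
  qed
qed

text \<open>Contract an equal pair, take a tree for the shorter list, and put the caret back. For length \<open>2\<close>
  the congruence leaves only two odd leaves, that is, a single caret.\<close>

lemma depth_parities_surj:
  assumes "length bs \<ge> 2" "\<not> distinct_adj bs" "excess bs mod 3 = 1"
  shows "\<exists>t. t \<noteq> Leaf \<and> depth_parities True t = bs"
  using assms
proof (induction "length bs" arbitrary: bs rule: less_induct)
  case less
  have "\<exists>us x vs t. bs = us @ x # x # vs \<and> depth_parities True t = us @ (\<not> x) # vs"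
  proof (cases "length bs = 2")
    case True
    then obtain y z where "bs = [y, z]" by (auto simp: length_Suc_conv numeral_2_eq_2)
    with less.prems have "bs = [] @ False # False # []" by (cases y; cases z) auto
    moreover have "depth_parities True Leaf = [] @ (\<not> False) # []" by simp
    ultimately show ?thesis by blast
  next
    case False
    then have "length bs > 2" using less.prems(1) by simp
    then obtain us x vs where bs: "bs = us @ x # x # vs" and na: "\<not> distinct_adj (us @ (\<not> x) # vs)"
      using contraction_not_alternating[of bs] less.prems by (metis zero_neq_one)
    have "excess (us @ (\<not> x) # vs) mod 3 = 1"
      using less.prems(3) unfolding bs excess_contract .
    moreover have "length (us @ (\<not> x) # vs) < length bs" by (simp add: bs)
    moreover have "length (us @ (\<not> x) # vs) \<ge> 2"
      using \<open>length bs > 2\<close> unfolding bs length_append list.size by linarith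
    ultimately have "\<exists>t. t \<noteq> Leaf \<and> depth_parities True t = us @ (\<not> x) # vs"
      using less.hyps na by blast
    then show ?thesis using bs by blast
  qed
  then show ?case using graft_caret by (metis (full_types))
qed

section \<open>Orbits and parity lists\<close>

definition rigid_parities :: "nat \<Rightarrow> bool list set" where
  "rigid_parities n = {bs. length bs = n + 1 \<and> excess bs mod 3 = 1 \<and> \<not> distinct_adj bs}"

lemma rigid_parities_iff:
  "bs \<in> rigid_parities n \<longleftrightarrow>
     length bs = n + 1 \<and> (\<exists>t. t \<noteq> Leaf \<and> depth_parities True t = bs)"
proof
  assume bs: "bs \<in> rigid_parities n"
  \<comment> \<open>Shorter lists are alternating.\<close>
  then have "length bs \<ge> 2"
    by (cases bs rule: remdups_adj.cases) (auto simp: rigid_parities_def)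
  then show "length bs = n + 1 \<and> (\<exists>t. t \<noteq> Leaf \<and> depth_parities True t = bs)"
    using bs depth_parities_surj by (auto simp: rigid_parities_def)
qed (auto simp: rigid_parities_def excess_depth_parities depth_parities_not_alternating)

lemma positive_rigid_vectors:
  "{c. length c = n + 1 \<and> positive_rigid_vector c} =
     {paint x bs | x bs. x \<noteq> 0 \<and> bs \<in> rigid_parities n}"
  unfolding positive_rigid_vector_iff_rigid_coloring rigid_parities_iff
  by (auto simp flip: paint_depth_parities) (metis length_paint)

lemma sum_list_paint: "bs \<in> rigid_parities n \<Longrightarrow> sum_list (paint x bs) = x"
  by (auto simp: rigid_parities_iff paint_depth_parities sum_list_rigid_coloring)

lemma color_orbit_map:
  assumes "p permutes {col1, col2, col3}"
  shows "color_orbit (map p c) = color_orbit c"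
proof -
  have "map q c \<in> color_orbit (map p c)" if "q permutes {col1, col2, col3}" for q
  proof -
    have "q \<circ> inv p permutes {col1, col2, col3}"
      using permutes_compose[OF permutes_inv[OF assms] that] .
    moreover have "map q c = map (q \<circ> inv p) (map p c)"
      using permutes_inverses[OF assms] by simp
    ultimately show ?thesis unfolding color_orbit_def by blast
  qed
  moreover have "map q (map p c) \<in> color_orbit c" if "q permutes {col1, col2, col3}" for q
    using permutes_compose[OF assms that] unfolding color_orbit_def map_map by blast
  ultimately show ?thesis
    unfolding color_orbit_def by blast
qed

lemma rot_permutes: "rot permutes {col1, col2, col3}"
proof (rule bij_imp_permutes)
  show "bij_betw rot {col1, col2, col3} {col1, col2, col3}"
    by (auto simp: bij_betw_def inj_on_def)
  show "rot x = x" if "x \<notin> {col1, col2, col3}" for x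
    using that nonzero_iff[of x] by auto
qed

text \<open>Rotation carries the vectors with one root color to those with the next, so every orbit is
  represented by a vector with root color \<open>1\<close>.\<close>

lemma color_orbit_paint:
  assumes "x \<noteq> 0"
  shows "color_orbit (paint x bs) = color_orbit (paint col1 bs)"
proof -
  have "color_orbit (paint (rot y) bs) = color_orbit (paint y bs)" for y
    using color_orbit_map[OF rot_permutes] by (simp flip: map_rot_paint)
  from this[of col1] this[of col2] show ?thesis
    using assms color_cases[of x] by auto
qed

lemma sum_of_other_colors:
  assumes "(a::color) \<noteq> 0" "b \<noteq> 0" "c \<noteq> 0" "a \<noteq> b" "c \<noteq> a" "c \<noteq> b"
  shows "a + b = c"
proof -
  have "a \<in> {col1, col2, col3}" "b \<in> {col1, col2, col3}" "c \<in> {col1, col2, col3}"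
    using assms(1-3) nonzero_iff by blast+
  then show ?thesis using assms(4-6) by auto
qed

text \<open>The symmetric group on the three nonzero colors is the general linear group of the plane over the
  field with two elements.\<close>

lemma permutes_colors_add:
  assumes "p permutes {col1, col2, col3}"
  shows "p (x + y) = p x + p y"
proof -
  have p0: "p 0 = 0" using permutes_not_in[OF assms, of 0] by simp
  have inj: "p u = p v \<longleftrightarrow> u = v" for u v
    using permutes_inj[OF assms] by (auto dest: injD)
  have nz: "p u = 0 \<longleftrightarrow> u = 0" for u using inj[of u 0] p0 by simp
  show ?thesis
  proof (cases "x = 0 \<or> y = 0 \<or> x = y")
    case True
    then show ?thesis using p0 by auto
  next
    case False
    have "x + y \<noteq> 0" using False color_add_self[of y] by (metis add_right_imp_eq)
    then show ?thesis
      using sum_of_other_colors[of "p x" "p y" "p (x + y)"] False by (simp add: inj nz)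
  qed
qed

lemma sum_list_permute_colors:
  assumes "p permutes {col1, col2, col3}"
  shows "sum_list (map p c) = p (sum_list c)"
proof (induction c)
  case Nil
  then show ?case using permutes_not_in[OF assms, of 0] by simp
next
  case (Cons x c)
  then show ?case using permutes_colors_add[OF assms] by simp
qed

text \<open>A permutation that maps one vector to the other fixes their common sum \<open>1\<close>, so it is the identity or
  the exchange of \<open>2\<close> and \<open>3\<close>; the latter would make \<open>bs\<close> alternating.\<close>

lemma color_orbit_paint_inj:
  assumes bs: "bs \<in> rigid_parities n" and bs': "bs' \<in> rigid_parities n"
    and eq: "color_orbit (paint col1 bs) = color_orbit (paint col1 bs')"
  shows "bs = bs'"
proof -
  have "map id (paint col1 bs') \<in> color_orbit (paint col1 bs')"
    unfolding color_orbit_def using permutes_id by blast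
  then obtain p where p: "p permutes {col1, col2, col3}"
    and map: "map p (paint col1 bs) = paint col1 bs'"
    unfolding eq[symmetric] by (auto simp: color_orbit_def)
  have 1: "p col1 = col1"
    using sum_list_permute_colors[OF p, of "paint col1 bs"] sum_list_paint[OF bs]
      sum_list_paint[OF bs'] map by simp
  have p': "p permutes {col2, col3}"
  proof (rule permutes_superset[OF p])
    show "p x = x" if "x \<in> {col1, col2, col3} - {col2, col3}" for x using 1 that by auto
  qed
  then consider "p = id" | "p = transpose col2 col3"
    by (auto simp: permutes_doubleton_iff)
  then show ?thesis
  proof cases
    case 1
    then show ?thesis using map paint_inject[of col1 bs bs'] by simp
  next
    case 2
    then have "distinct_adj bs" using map swapped_paint_alternates(1) by blast
    then show ?thesis using bs by (simp add: rigid_parities_def)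
  qed
qed

lemma rigid_count_eq_card_parities: "rigid_count n = card (rigid_parities n)"
proof -
  have "color_orbit ` {c. length c = n + 1 \<and> positive_rigid_vector c} =
      (\<lambda>bs. color_orbit (paint col1 bs)) ` rigid_parities n"
  proof (intro equalityI subsetI)
    fix S
    assume "S \<in> color_orbit ` {c. length c = n + 1 \<and> positive_rigid_vector c}"
    then obtain x bs where "S = color_orbit (paint x bs)" "x \<noteq> 0" "bs \<in> rigid_parities n"
      unfolding positive_rigid_vectors by blast
    then show "S \<in> (\<lambda>bs. color_orbit (paint col1 bs)) ` rigid_parities n"
      using color_orbit_paint[of x bs] by blast
  next
    fix S
    assume "S \<in> (\<lambda>bs. color_orbit (paint col1 bs)) ` rigid_parities n"
    then show "S \<in> color_orbit ` {c. length c = n + 1 \<and> positive_rigid_vector c}"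
      unfolding positive_rigid_vectors using color_neq(1) by blast
  qed
  moreover have "inj_on (\<lambda>bs. color_orbit (paint col1 bs)) (rigid_parities n)"
    by (rule inj_onI) (rule color_orbit_paint_inj)
  ultimately show ?thesis
    unfolding rigid_count_def by (simp add: card_image)
qed

section \<open>Counting parity lists\<close>

definition with_excess :: "nat \<Rightarrow> int \<Rightarrow> bool list set" where
  "with_excess N r = {bs. length bs = N \<and> excess bs mod 3 = r}"

lemma finite_with_excess [simp]: "finite (with_excess N r)"
  unfolding with_excess_def
  using finite_lists_length_eq[of "UNIV :: bool set" N] by simp

text \<open>A tail of excess \<open>0\<close> needs \<open>True\<close> in front, a tail of excess \<open>2\<close> needs \<open>False\<close>, and a tail of excess
  \<open>1\<close> cannot be completed. The lists of excess \<open>1\<close> of lengths \<open>N\<close> and \<open>N + 1\<close> thus together number as many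
  as all lists of length \<open>N\<close>.\<close>

lemma card_with_excess_Suc: "card (with_excess N 1) + card (with_excess (Suc N) 1) = 2 ^ N"
proof -
  have mod: "(1 + e) mod 3 = 1 \<longleftrightarrow> e mod 3 = 0" "(e - 1) mod 3 = 1 \<longleftrightarrow> e mod 3 = 2" for e :: int
    by presburger+
  have "with_excess (Suc N) 1 = Cons True ` with_excess N 0 \<union> Cons False ` with_excess N 2"
    by (auto simp: with_excess_def length_Suc_conv mod image_iff split: if_splits)
  moreover have "card (Cons True ` with_excess N 0 \<union> Cons False ` with_excess N 2) =
      card (with_excess N 0) + card (with_excess N 2)"
    by (subst card_Un_disjoint) (auto simp: card_image)
  moreover have "card (with_excess N 0) + card (with_excess N 2) + card (with_excess N 1) = 2 ^ N"
  proof -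
    have "{bs :: bool list. length bs = N} = with_excess N 0 \<union> with_excess N 2 \<union> with_excess N 1"
      by (auto simp: with_excess_def)
    moreover have "card {bs :: bool list. length bs = N} = 2 ^ N"
      using card_lists_length_eq[of "UNIV :: bool set" N] by simp
    moreover have "with_excess N 0 \<inter> with_excess N 2 = {}"
      "(with_excess N 0 \<union> with_excess N 2) \<inter> with_excess N 1 = {}"
      by (auto simp: with_excess_def)
    ultimately show ?thesis by (simp add: card_Un_disjoint)
  qed
  ultimately show ?thesis by simp
qed

lemma distinct_adj_bool_iff:
  "distinct_adj (b # bs) \<longleftrightarrow> b # bs = map (\<lambda>i. even i = b) [0..<Suc (length bs)]"
proof (induction bs arbitrary: b)
  case (Cons c bs)
  have "map (\<lambda>i. even i = b) [0..<Suc (Suc (length bs))] =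
      b # map (\<lambda>i. even i = (\<not> b)) [0..<Suc (length bs)]"
    by (subst upt_conv_Cons) (auto simp flip: map_Suc_upt simp del: upt_Suc)
  then show ?case
    using Cons[of c] by (cases "c = b") (auto simp del: upt_Suc simp: upt_conv_Cons)
qed simp

lemma excess_alternating:
  "excess (map (\<lambda>i. even i = b) [0..<n]) = (if even n then 0 else if b then 1 else - 1)"
  by (induction n) auto

text \<open>For odd length an alternating list has excess \<open>1\<close> or \<open>-1\<close>, by its first entry; for even length the
  excess is \<open>0\<close>.\<close>

lemma card_alternating:
  "card {bs \<in> with_excess (n + 1) 1. distinct_adj bs} = (if even n then 1 else 0)"
proof -
  let ?zig = "\<lambda>b. map (\<lambda>i. even i = b) [0..<n + 1]"
  have "bs \<in> range ?zig" if "distinct_adj bs" "length bs = n + 1" for bs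
  proof -
    obtain c cs where "bs = c # cs" using \<open>length bs = n + 1\<close> by (cases bs) auto
    with that distinct_adj_bool_iff[of c cs] have "bs = ?zig c" by simp
    then show ?thesis by blast
  qed
  moreover have "distinct_adj (?zig b)" for b
    by (auto simp: distinct_adj_conv_nth simp del: upt_Suc)
  ultimately have "{bs \<in> with_excess (n + 1) 1. distinct_adj bs} =
      ?zig ` {b. excess (?zig b) mod 3 = 1}"
    by (fastforce simp: with_excess_def simp del: upt_Suc)
  also have "{b. excess (?zig b) mod 3 = 1} = (if even n then {True} else {})"
    unfolding excess_alternating by auto
  finally show ?thesis by simp
qed

lemma card_rigid_parities:
  "card (rigid_parities n) + (if even n then 1 else 0) = card (with_excess (n + 1) 1)"
proof -
  have "with_excess (n + 1) 1 = rigid_parities n \<union> {bs \<in> with_excess (n + 1) 1. distinct_adj bs}"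
    and "rigid_parities n \<inter> {bs \<in> with_excess (n + 1) 1. distinct_adj bs} = {}"
    and "rigid_parities n \<subseteq> with_excess (n + 1) 1"
    by (auto simp: rigid_parities_def with_excess_def)
  then have "card (with_excess (n + 1) 1) =
      card (rigid_parities n) + card {bs \<in> with_excess (n + 1) 1. distinct_adj bs}"
    by (metis (no_types, lifting) card_Un_disjoint finite_Un finite_with_excess)
  then show ?thesis unfolding card_alternating by simp
qed

text \<open>Exactly one of \<open>n\<close> and \<open>n + 1\<close> is even, so exactly one alternating list is left out of the two
  counts; it is the summand \<open>1\<close>.\<close>

lemma rigid_count_add: "rigid_count n + rigid_count (n + 1) + 1 = 2 ^ (n + 1)"
  using card_with_excess_Suc[of "n + 1"] card_rigid_parities[of n] card_rigid_parities[of "n + 1"]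
  by (simp add: rigid_count_eq_card_parities split: if_splits)

text \<open>The identity \<open>r(n) + r(n + 1) + 1 = 2\<^bsup>n+1\<^esup>\<close> starts at \<open>n = 0\<close> with \<open>r(0) = 0\<close>.
  Twice its instance at \<open>n - 1\<close> and the one at \<open>n\<close> have the same power of \<open>2\<close>, and equating them yields the recurrence.\<close>

theorem proposition15p4:
  "rigid_count 1 = 1 \<and> rigid_count 2 = 2 \<and>
   (\<forall>n \<ge> 2. rigid_count (n + 1) = rigid_count n + 2 * rigid_count (n - 1) + 1)"
proof (intro conjI allI impI)
  have "rigid_parities 0 = {}"
    by (auto simp: rigid_parities_def length_Suc_conv)
  then have 0: "rigid_count 0 = 0" by (simp add: rigid_count_eq_card_parities)
  then show 1: "rigid_count 1 = 1" using rigid_count_add[of 0] by simp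
  then show "rigid_count 2 = 2" using rigid_count_add[of 1] by (simp add: numeral_2_eq_2)
  fix n :: nat
  assume "n \<ge> 2"
  then obtain m where n: "n = Suc m" by (cases n) auto
  show "rigid_count (n + 1) = rigid_count n + 2 * rigid_count (n - 1) + 1"
    using rigid_count_add[of m] rigid_count_add[of n] by (simp add: n)
qed

end
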